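(* Let $n$ be a nonnegative integer. Then $$\sum_{k=0}^n q^k\, \frac{(-q^{k+1};q)_{n-k+1}\,(-q^{k+2};q)_{n-k}}{(-q;q)_{n-k+1}\,(-q;q)_{n-k}}\, T_{k,1}(q)\, T_{n-k,1}(q) = (1+q)\, T_{n+1,1}(q).$$
   Context: $q$ is an indeterminate; identities are in the field of rational functions in $q$. $(a;q)_0=1$ and $(a;q)_n=\prod_{k=0}^{n-1}(1-aq^k)$ for $n\ge 1$. $[i]_q=\frac{1-q^i}{1-q}$ and $[k]_q!=\prod_{i=1}^k [i]_q$. The $q$-super Catalan numbers are, for nonnegative integers $n,m$, $T_{n,m}(q)=\frac{[2m]_q!\,[2n]_q!}{[m]_q!\,[n]_q!\,[m+n]_q!}$. (In particular $T_{n,1}(q)=(1+q)C_n(q)$ where $C_n(q)=\frac{1}{[n+1]_q}\frac{[2n]_q!}{[n]_q!^2}$ is the $q$-Catalan number.) *)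

theory Defs
  imports "HOL-Computational_Algebra.Computational_Algebra"
begin

definition q_pochhammer :: "'a::field \<Rightarrow> 'a \<Rightarrow> nat \<Rightarrow> 'a" where
  "q_pochhammer a q n = (\<Prod>k<n. 1 - a * q ^ k)"

definition q_int :: "'a::field \<Rightarrow> nat \<Rightarrow> 'a" where
  "q_int q i = (1 - q ^ i) / (1 - q)"

definition q_fact :: "'a::field \<Rightarrow> nat \<Rightarrow> 'a" where
  "q_fact q k = (\<Prod>i=1..k. q_int q i)"

definition q_super_catalan :: "'a::field \<Rightarrow> nat \<Rightarrow> nat \<Rightarrow> 'a" where
  "q_super_catalan q n m =
     (q_fact q (2 * m) * q_fact q (2 * n)) / (q_fact q m * q_fact q n * q_fact q (m + n))"

(* The indeterminate X of the field Q(X) of rational functions. It is transcendental over Q,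
   so no denominator occurring above vanishes when q is instantiated with it. *)
definition q_indet :: "rat poly fract" where
  "q_indet = Fract [:0, 1:] 1"

end

theory Submission
  imports Defs
begin

text \<open>
  Write \<open>P\<^sub>j = (-q;q)\<^sub>j\<close> and \<open>b\<^sub>j = (q\<^sup>-\<^sup>1;q\<^sup>2)\<^sub>j / (q\<^sup>2;q\<^sup>2)\<^sub>j\<close>. The first quotient of the sum is
  \<open>P\<^sub>n\<^sub>+\<^sub>1\<^sup>2 / (P\<^sub>k P\<^sub>k\<^sub>+\<^sub>1 P\<^sub>n\<^sub>-\<^sub>k P\<^sub>n\<^sub>-\<^sub>k\<^sub>+\<^sub>1)\<close>, and \<open>T\<^sub>k\<^sub>,\<^sub>1 / (P\<^sub>k P\<^sub>k\<^sub>+\<^sub>1) = -q (1 + q) b\<^sub>k\<^sub>+\<^sub>1\<close>. By the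
  \<open>q\<close>-binomial theorem the generating function \<open>B\<close> of the \<open>b\<^sub>j\<close> satisfies \<open>B(z) B(qz) = 1 - z/q\<close>.
  The coefficient of \<open>z\<^sup>n\<^sup>+\<^sup>2\<close> on the left therefore vanishes, and isolating its two extreme terms
  gives the recurrence.
\<close>

lemma q_pochhammer_0 [simp]: "q_pochhammer a q 0 = 1"
  by (simp add: q_pochhammer_def)

lemma q_pochhammer_Suc: "q_pochhammer a q (Suc n) = q_pochhammer a q n * (1 - a * q ^ n)"
  by (simp add: q_pochhammer_def)

lemma q_pochhammer_add:
  "q_pochhammer a q (m + n) = q_pochhammer a q m * q_pochhammer (a * q ^ m) q n"
  by (induction n) (simp_all add: q_pochhammer_Suc power_add mult.assoc)

text \<open>Coefficients of the \<open>q\<close>-binomial series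
  \<open>(az;p)_inf / (z;p)_inf\<close>; the \<open>b_j\<close> are the case \<open>a = 1/q\<close>,
  \<open>p = q^2\<close>.\<close>

definition q_binom_coeff :: "'a::field \<Rightarrow> 'a \<Rightarrow> nat \<Rightarrow> 'a" where
  "q_binom_coeff a p j = q_pochhammer a p j / q_pochhammer p p j"

lemma q_binom_coeff_0 [simp]: "q_binom_coeff a p 0 = 1"
  by (simp add: q_binom_coeff_def)

lemma q_binom_coeff_Suc:
  "q_binom_coeff a p (Suc j) = q_binom_coeff a p j * ((1 - a * p ^ j) / (1 - p ^ Suc j))"
  by (simp add: q_binom_coeff_def q_pochhammer_Suc)

text \<open>A formal version of the \<open>q\<close>-binomial theorem that avoids infinite products.
  The coefficient of \<open>z^(j+1)\<close> is the ratio recurrence of the coefficients, cleared of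
  denominators.\<close>

lemma q_binom_fps_functional_equation:
  fixes a p :: "'a::field"
  assumes "\<And>m. m > 0 \<Longrightarrow> p ^ m \<noteq> 1"
  shows "(1 - fps_X) * Abs_fps (q_binom_coeff a p) =
         (1 - fps_const a * fps_X) * (Abs_fps (q_binom_coeff a p) oo (fps_const p * fps_X))"
proof (rule fps_ext)
  fix n
  show "((1 - fps_X) * Abs_fps (q_binom_coeff a p)) $ n =
     ((1 - fps_const a * fps_X) * (Abs_fps (q_binom_coeff a p) oo (fps_const p * fps_X))) $ n"
  proof (cases n)
    case 0
    then show ?thesis by (simp add: fps_compose_linear)
  next
    case (Suc j)
    have "1 - p ^ Suc j \<noteq> 0"
      using assms[of "Suc j"] by simp
    then have "(1 - p ^ Suc j) * q_binom_coeff a p (Suc j) = (1 - a * p ^ j) * q_binom_coeff a p j"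
      by (simp add: q_binom_coeff_Suc)
    then show ?thesis
      unfolding Suc fps_compose_linear by (simp add: algebra_simps)
  qed
qed

text \<open>With \<open>H(z) = B(z) B(qz)\<close> one has \<open>H(qz) = B(qz) B(q^2 z)\<close>, so
  the functional equation of \<open>B\<close> in base \<open>q^2\<close> becomes one for
  \<open>H\<close> in base \<open>q\<close>. The sum is a coefficient of \<open>H\<close> of degree
  at least 2.\<close>

lemma q_binom_convolution_eq_0:
  fixes q :: "'a::field"
  assumes q: "\<And>m. m > 0 \<Longrightarrow> q ^ m \<noteq> 1" and "q \<noteq> 0"
  defines "b \<equiv> q_binom_coeff (1 / q) (q ^ 2)"
  shows "(\<Sum>j=0..n + 2. q ^ j * b j * b (n + 2 - j)) = 0"
proof -
  define B where "B = Abs_fps b"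
  define Bq where "Bq = B oo (fps_const q * fps_X)"
  define H where "H = Bq * B"
  have Bqq: "Bq oo (fps_const q * fps_X) = B oo (fps_const (q ^ 2) * fps_X)"
    by (simp add: Bq_def fps_compose_linear fps_eq_iff power_mult power2_eq_square
        power_mult_distrib)
  have "(1 - fps_X) * B = (1 - fps_const (1 / q) * fps_X) * (B oo (fps_const (q ^ 2) * fps_X))"
    unfolding B_def b_def
  proof (rule q_binom_fps_functional_equation)
    show "(q ^ 2) ^ m \<noteq> 1" if "m > 0" for m
      using q[of "2 * m"] that by (simp add: power_mult)
  qed
  then have "(1 - fps_X) * H =
      (1 - fps_const (1 / q) * fps_X) * (B oo (fps_const (q ^ 2) * fps_X)) * Bq"
    by (simp add: H_def mult_ac)
  also have "\<dots> = (1 - fps_const (1 / q) * fps_X) * (H oo (fps_const q * fps_X))"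
  proof -
    have "H oo (fps_const q * fps_X) = (B oo (fps_const (q ^ 2) * fps_X)) * Bq"
      unfolding H_def Bqq[symmetric] by (subst fps_compose_mult_distrib) (simp_all add: Bq_def)
    then show ?thesis by (simp only: mult.assoc)
  qed
  finally have H: "(1 - fps_X) * H =
      (1 - fps_const (1 / q) * fps_X) * (H oo (fps_const q * fps_X))" .
  \<comment> \<open>The factor \<open>1/q\<close> lowers \<open>q^(m+1)\<close> to
    \<open>q^m\<close>. Hence the right side vanishes at \<open>m = 0\<close>, and this zero
    propagates to all higher coefficients.\<close>
  have rec: "(1 - q ^ (m + 2)) * H $ (m + 2) = (1 - q ^ m) * H $ (m + 1)" for m
  proof -
    have "((1 - fps_X) * H) $ (m + 2) =
        ((1 - fps_const (1 / q) * fps_X) * (H oo (fps_const q * fps_X))) $ (m + 2)"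
      by (simp only: H)
    then show ?thesis
      unfolding fps_compose_linear using \<open>q \<noteq> 0\<close>
      by (simp add: algebra_simps)
  qed
  have "H $ (n + 2) = 0"
  proof (induction n)
    case 0
    then show ?case using rec[of 0] q[of 2] by (simp add: power2_eq_square)
  next
    case (Suc n)
    then show ?case using rec[of "Suc n"] q[of "Suc n + 2"] by simp
  qed
  then show ?thesis
    by (simp add: H_def Bq_def B_def fps_compose_linear fps_mult_nth)
qed

lemma q_fact_Suc: "q_fact q (Suc k) = q_fact q k * q_int q (Suc k)"
  by (simp add: q_fact_def)

lemma q_int_double: "q_int q (2 * k) = q_int q k * (1 + q ^ k)"
  by (simp add: q_int_def power_mult power2_eq_square algebra_simps flip: mult_2)

lemma one_plus_power_nonzero:
  fixes q :: "'a::field"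
  assumes "\<And>m. m > 0 \<Longrightarrow> q ^ m \<noteq> 1" and "m > 0"
  shows "1 + q ^ m \<noteq> 0"
proof
  assume "1 + q ^ m = 0"
  then have "q ^ m = -1" by (simp add: eq_neg_iff_add_eq_0 add.commute)
  then have "q ^ (2 * m) = 1" by (simp add: power_mult[of q m 2] mult.commute)
  with assms show False by simp
qed

lemma q_pochhammer_minus_nonzero:
  fixes q :: "'a::field"
  assumes "\<And>m. m > 0 \<Longrightarrow> q ^ m \<noteq> 1"
  shows "q_pochhammer (- q) q n \<noteq> 0"
proof (induction n)
  case (Suc n)
  then show ?case
    using one_plus_power_nonzero[OF assms, of "Suc n"] by (simp add: q_pochhammer_Suc)
qed simp

text \<open>The ratio is \<open>[2k+1][2k+2] / ([k+1][k+2])\<close>, and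
  \<open>[2k+2] = [k+1](1 + q^(k+1))\<close>.\<close>

lemma q_super_catalan_Suc_1:
  fixes q :: "'a::field"
  assumes q: "\<And>m. m > 0 \<Longrightarrow> q ^ m \<noteq> 1"
  shows "q_super_catalan q (Suc k) 1 = q_super_catalan q k 1 *
           ((1 + q ^ Suc k) * (1 - q ^ (2 * k + 1)) / (1 - q ^ (k + 2)))"
proof -
  have i: "q_int q m \<noteq> 0" if "m > 0" for m
    using q[of m] q[of 1] that by (simp add: q_int_def)
  have f: "q_fact q m \<noteq> 0" for m
    by (induction m) (simp_all add: q_fact_Suc i, simp add: q_fact_def)
  have 1: "q_fact q (2 * Suc k) =
      q_fact q (2 * k) * q_int q (2 * k + 1) * (q_int q (Suc k) * (1 + q ^ Suc k))"
    using q_int_double[of q "Suc k"] by (simp add: q_fact_Suc)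
  have 2: "q_int q (2 * k + 1) / q_int q (k + 2) = (1 - q ^ (2 * k + 1)) / (1 - q ^ (k + 2))"
    using q[of 1] by (simp add: q_int_def)
  have "q_super_catalan q (Suc k) 1 = q_super_catalan q k 1 *
      ((1 + q ^ Suc k) * (q_int q (2 * k + 1) / q_int q (k + 2)))"
    unfolding q_super_catalan_def 1
    using i[of "Suc k"] i[of "k + 2"] f[of k] f[of "Suc k"] f[of 1]
    by (simp add: q_fact_Suc field_simps)
  then show ?thesis
    unfolding 2 by simp
qed

text \<open>Both sides have the same ratio of consecutive terms; the constant \<open>-q(1+q)\<close>
  comes from \<open>k = 0\<close>, where \<open>b_1 = -1/(q(1+q))\<close>.\<close>

lemma q_super_catalan_1_eq_q_binom_coeff:
  fixes q :: "'a::field"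
  assumes q: "\<And>m. m > 0 \<Longrightarrow> q ^ m \<noteq> 1" and "q \<noteq> 0"
  shows "q_super_catalan q k 1 = - q * (1 + q) * q_binom_coeff (1 / q) (q ^ 2) (Suc k) *
           (q_pochhammer (- q) q k * q_pochhammer (- q) q (Suc k))"
proof (induction k)
  case 0
  have q1: "1 - q \<noteq> 0" using q[of 1] by simp
  have p2: "1 + q \<noteq> 0" using one_plus_power_nonzero[OF q, of 1] by simp
  have "1 - q ^ 2 = (1 - q) * (1 + q)" by (simp add: power2_eq_square algebra_simps)
  then show ?case
    using q1 p2 \<open>q \<noteq> 0\<close>
    by (simp add: q_super_catalan_def q_fact_def q_int_def q_binom_coeff_Suc q_pochhammer_Suc
        numeral_2_eq_2 field_simps)
next
  case (Suc k)
  let ?b = "q_binom_coeff (1 / q) (q\<^sup>2)" and ?P = "q_pochhammer (- q) q"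
  have n: "1 - q ^ (k + 2) \<noteq> 0" "1 + q ^ (k + 2) \<noteq> 0"
    using q[of "k + 2"] one_plus_power_nonzero[OF q, of "k + 2"] by auto
  have e: "1 - (q\<^sup>2) ^ Suc (Suc k) = (1 - q ^ (k + 2)) * (1 + q ^ (k + 2))"
    by (simp add: algebra_simps power2_eq_square power_mult_distrib)
  \<comment> \<open>The choice \<open>a = 1/q\<close> produces the odd exponent of
    \<open>[2k+1]\<close>.\<close>
  have d: "1 / q * (q\<^sup>2) ^ Suc k = q ^ (2 * k + 1)"
    using \<open>q \<noteq> 0\<close> by (simp add: power2_eq_square power_mult_distrib mult_2 power_add)
  have b: "?b (Suc (Suc k)) * (1 + q ^ (k + 2)) =
      ?b (Suc k) * ((1 - q ^ (2 * k + 1)) / (1 - q ^ (k + 2)))"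
    unfolding q_binom_coeff_Suc[of _ _ "Suc k"] e d using n by simp
  have P: "?P (Suc k) = ?P k * (1 + q ^ Suc k)"
      "?P (Suc (Suc k)) = ?P (Suc k) * (1 + q ^ (k + 2))"
    by (simp_all add: q_pochhammer_Suc)
  have "- q * (1 + q) * ?b (Suc (Suc k)) * (?P (Suc k) * ?P (Suc (Suc k))) =
      - q * (1 + q) * (?b (Suc (Suc k)) * (1 + q ^ (k + 2))) * (?P (Suc k) * ?P (Suc k))"
    unfolding P(2) by (simp only: mult_ac)
  also have "\<dots> = - q * (1 + q) * ?b (Suc k) * ((1 - q ^ (2 * k + 1)) / (1 - q ^ (k + 2)))
      * ((?P k * (1 + q ^ Suc k)) * ?P (Suc k))"
    unfolding b by (simp only: P(1) mult_ac)
  also have "\<dots> = (- q * (1 + q) * ?b (Suc k) * (?P k * ?P (Suc k))) *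
      ((1 + q ^ Suc k) * (1 - q ^ (2 * k + 1)) / (1 - q ^ (k + 2)))"
    by (simp add: mult_ac)
  also have "\<dots> = q_super_catalan q (Suc k) 1"
    by (simp only: q_super_catalan_Suc_1[OF q] Suc.IH)
  finally show ?case ..
qed

theorem q_super_catalan_1_convolution:
  fixes q :: "'a::field"
  assumes q: "\<And>m. m > 0 \<Longrightarrow> q ^ m \<noteq> 1" and "q \<noteq> 0"
  shows "(\<Sum>k=0..n. q ^ k *
            (q_pochhammer (- (q ^ (k + 1))) q (n - k + 1) * q_pochhammer (- (q ^ (k + 2))) q (n - k) /
             (q_pochhammer (- q) q (n - k + 1) * q_pochhammer (- q) q (n - k))) *
            q_super_catalan q k 1 * q_super_catalan q (n - k) 1)
         = (1 + q) * q_super_catalan q (n + 1) 1" (is "?lhs = _")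
proof -
  let ?b = "q_binom_coeff (1 / q) (q\<^sup>2)" and ?P = "q_pochhammer (- q) q"
  \<comment> \<open>Everything independent of \<open>k\<close>; of the \<open>q^2\<close>
    contributed by the two Catalan factors, one \<open>q\<close> goes into
    \<open>q^(k+1)\<close>.\<close>
  define c where "c = q * (1 + q) ^ 2 * ?P (n + 1) ^ 2"
  have P0: "?P m \<noteq> 0" for m
    using q by (rule q_pochhammer_minus_nonzero)
  have T: "q_super_catalan q m 1 = - q * (1 + q) * ?b (Suc m) * (?P m * ?P (Suc m))" for m
    using assms by (rule q_super_catalan_1_eq_q_binom_coeff)
  have summand: "q ^ k *
      (q_pochhammer (- (q ^ (k + 1))) q (n - k + 1) * q_pochhammer (- (q ^ (k + 2))) q (n - k) /
        (?P (n - k + 1) * ?P (n - k))) * q_super_catalan q k 1 * q_super_catalan q (n - k) 1 =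
      c * (q ^ Suc k * ?b (Suc k) * ?b (n + 2 - Suc k))" if "k \<le> n" for k
  proof -
    \<comment> \<open>Splitting \<open>(-q;q)_(n+1)\<close> after \<open>k\<close> and after
      \<open>k+1\<close> factors shows that the numerators are \<open>P_(n+1)/P_k\<close> and
      \<open>P_(n+1)/P_(k+1)\<close>.\<close>
    have 1: "?P k * q_pochhammer (- (q ^ (k + 1))) q (n - k + 1) = ?P (n + 1)"
      using q_pochhammer_add[of "- q" q k "n - k + 1"] that by simp
    have 2: "?P (k + 1) * q_pochhammer (- (q ^ (k + 2))) q (n - k) = ?P (n + 1)"
      using q_pochhammer_add[of "- q" q "k + 1" "n - k"] that by simp
    have 3: "n + 2 - Suc k = Suc (n - k)" using that by simp
    let ?U = "q_pochhammer (- (q ^ (k + 1))) q (n - k + 1)"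
      and ?V = "q_pochhammer (- (q ^ (k + 2))) q (n - k)"
    \<comment> \<open>The \<open>P\<close> factors of the second Catalan term cancel the
      denominator; those of the first complete the numerators.\<close>
    have aux: "x * (u * v / (y * z)) * (s * b * (p * p')) * (s * b' * (z * y)) =
        x * s\<^sup>2 * ((p * u) * (p' * v)) * b * b'"
      if "y \<noteq> 0" "z \<noteq> 0" for x u v y z s b b' p p' :: 'a
      using that by (simp add: power2_eq_square mult_ac)
    have "q ^ k * (?U * ?V / (?P (n - k + 1) * ?P (n - k))) *
        q_super_catalan q k 1 * q_super_catalan q (n - k) 1 =
        q ^ k * (- q * (1 + q))\<^sup>2 * ((?P k * ?U) * (?P (k + 1) * ?V)) * ?b (Suc k) * ?b (Suc (n - k))"
      unfolding T Suc_eq_plus1 by (rule aux[OF P0 P0])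
    then show ?thesis
      unfolding 1 2 3 c_def by (simp add: power2_eq_square mult_ac)
  qed
  have "0 = (\<Sum>j=0..n + 2. q ^ j * ?b j * ?b (n + 2 - j))"
    using q_binom_convolution_eq_0[OF q \<open>q \<noteq> 0\<close>, of n] by simp
  \<comment> \<open>Since \<open>b_0 = 1\<close>, the terms \<open>j = 0\<close> and
    \<open>j = n+2\<close> are both multiples of \<open>b_(n+2)\<close>; the others are indexed by
    \<open>j = k+1\<close>.\<close>
  also have "\<dots> = ?b (n + 2) + (\<Sum>k=0..n. q ^ Suc k * ?b (Suc k) * ?b (n + 2 - Suc k)) +
      q ^ (n + 2) * ?b (n + 2)"
    unfolding add_2_eq_Suc' sum.atLeast0_atMost_Suc_shift[of _ "Suc n"]
      sum.atLeast0_atMost_Suc[of _ n] by simp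
  finally have S: "(\<Sum>k=0..n. q ^ Suc k * ?b (Suc k) * ?b (n + 2 - Suc k)) =
      - ((1 + q ^ (n + 2)) * ?b (n + 2))"
    by (simp add: algebra_simps eq_neg_iff_add_eq_0)
  \<comment> \<open>The factor \<open>1 + q^(n+2)\<close> from the two extreme terms turns one
    \<open>P_(n+1)\<close> of \<open>c\<close> into \<open>P_(n+2)\<close>, as
    \<open>T_(n+1,1)\<close> requires.\<close>
  have "?P (Suc (n + 1)) = ?P (n + 1) * (1 + q ^ (n + 2))"
    by (simp add: q_pochhammer_Suc)
  then have T_Suc: "q_super_catalan q (n + 1) 1 =
      - q * (1 + q) * ?b (n + 2) * (?P (n + 1) * (?P (n + 1) * (1 + q ^ (n + 2))))"
    using T[of "n + 1"] by simp
  have "c * - ((1 + q ^ (n + 2)) * ?b (n + 2)) = (1 + q) * q_super_catalan q (n + 1) 1"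
    unfolding T_Suc c_def by (simp only: power2_eq_square mult_minus_left mult_minus_right mult_ac)
  moreover have "?lhs = c * (\<Sum>k=0..n. q ^ Suc k * ?b (Suc k) * ?b (n + 2 - Suc k))"
    unfolding sum_distrib_left by (intro sum.cong refl summand) simp
  ultimately show ?thesis
    unfolding S by simp
qed

text \<open>Reduces \<open>q_indet ^ m \<noteq> 1\<close> to the fact that a monomial of positive
  degree is not the constant 1.\<close>

lemma q_indet_power: "q_indet ^ m = Fract (monom 1 m) 1"
  by (induction m) (simp_all add: q_indet_def One_fract_def monom_Suc)

theorem proposition5:
  fixes n :: nat and q :: "rat poly fract"
  defines "q \<equiv> q_indet"
  shows "(\<Sum>k=0..n. q ^ k *
            (q_pochhammer (- (q ^ (k + 1))) q (n - k + 1) * q_pochhammer (- (q ^ (k + 2))) q (n - k) /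
             (q_pochhammer (- q) q (n - k + 1) * q_pochhammer (- q) q (n - k))) *
            q_super_catalan q k 1 * q_super_catalan q (n - k) 1)
         = (1 + q) * q_super_catalan q (n + 1) 1"
  unfolding q_def
proof (rule q_super_catalan_1_convolution)
  show "q_indet ^ m \<noteq> 1" if "m > 0" for m
    using that by (simp add: q_indet_power One_fract_def eq_fract monom_eq_1_iff)
  show "q_indet \<noteq> 0"
    by (simp add: q_indet_def Zero_fract_def eq_fract)
qed

end
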